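(* Let $E,F$ be Banach spaces over the same field $\mathbb K\in\{\mathbb R,\mathbb C\}$, let $U\subseteq E$ be open, let $f\colon U\to F$ be differentiable (at every point of $U$), and let $x_0\in U$. Then $Df\colon U\to\mathcal L(E,F)$ is continuous at $x_0$ if and only if there exists a slope function $\Phi\colon U\times U\to\mathcal L(E,F)$ for $f$ that is jointly continuous at $(x_0,x_0)$ as a function of $(x,y)$. In that case, the canonical slope function of $f$ is jointly continuous at $(x_0,x_0)$.
   Context: $\mathcal L(E,F)$ denotes the space of bounded linear operators from $E$ to $F$ with the operator norm; $E'=\mathcal L(E,\mathbb K)$ is the dual space. Differentiability: $f\colon U\to F$ is differentiable at $x\in U$ if there exists a map $\Phi_x\colon U\to\mathcal L(E,F)$, continuous at $x$, such that $f(y)=f(x)+\Phi_x(y)(y-x)$ for all $y\in U$. Such a $\Phi_x$ is called a slope function of $f$ at $x$, and $Df(x):=\Phi_x(x)$ is the derivative of $f$ at $x$ (this is equivalent to Fréchet differentiability, with the same derivative, which is unique). If $f$ is differentiable at every point of $U$, a slope function for $f$ is a map $\Phi\colon U\times U\to\mathcal L(E,F)$ such that for every $x\in U$ the map $y\mapsto\Phi(x,y)$ is a slope function of $f$ at $x$; thus $f(y)=f(x)+\Phi(x,y)(y-x)$ for all $x,y\in U$, $y\mapsto \Phi(x,y)$ is continuous at $y=x$, and $Df(x)=\Phi(x,x)$. Canonical slope function: for each pair $x\neq y$ in $U$ choose (by the Hahn-Banach theorem) $\ell(x,y)\in E'$ with $\|\ell(x,y)\|_{E'}=1$ and $\langle\ell(x,y),y-x\rangle=\|y-x\|$.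 The (associated) canonical slope function is given, for $z\in E$, by $$\Phi(x,y)z:=\frac{f(y)-f(x)-Df(x)(y-x)}{\|y-x\|}\langle\ell(x,y),z\rangle+Df(x)z\quad\text{if }x\neq y,\qquad \Phi(x,x)z:=Df(x)z.$$ The assertion about the canonical slope function holds for any such choice of the functionals $\ell(x,y)$. *)

theory Defs
  imports "HOL-Analysis.Analysis"
begin

text \<open>
  The library has no complex normed vector spaces. A Banach space over a scalar field \<open>'k\<close>,
  which is \<open>\<real>\<close> or \<open>\<complex>\<close>, is therefore rendered as a type of class
  \<^class>\<open>banach\<close> (this carries the norm, completeness and the underlying real structure)
  together with an explicit scalar multiplication by elements of \<open>'k\<close> that extends the real one.
  The following class says that \<open>'k\<close> is, up to isometric isomorphism of fields over the reals,
  either \<open>\<real>\<close> or \<open>\<complex>\<close>.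
\<close>

class real_or_complex = real_normed_field +
  assumes real_or_complex:
    "\<exists>\<phi> :: 'a \<Rightarrow> complex.
       (\<forall>a b. \<phi> (a + b) = \<phi> a + \<phi> b) \<and> (\<forall>a b. \<phi> (a * b) = \<phi> a * \<phi> b) \<and> \<phi> 1 = 1 \<and>
       (\<forall>r a. \<phi> (r *\<^sub>R a) = r *\<^sub>R \<phi> a) \<and> (\<forall>a. norm (\<phi> a) = norm a) \<and>
       (range \<phi> = \<real> \<or> range \<phi> = UNIV)"

instance real :: real_or_complex
  by standard (rule exI[of _ complex_of_real], auto simp: Reals_def scaleR_conv_of_real)

instance complex :: real_or_complex
  by standard (rule exI[of _ "\<lambda>z. z"], auto)

locale banach_over = vector_space scale
  for scale :: "'k::real_or_complex \<Rightarrow> 'e::banach \<Rightarrow> 'e" +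
  assumes scale_of_real: "scale (of_real r) x = r *\<^sub>R x"
    and norm_scale: "norm (scale c x) = norm c * norm x"

text \<open>
  The type \<open>'e \<Rightarrow>\<^sub>L 'f\<close> consists of the bounded real-linear operators with the operator norm.
  The space of bounded \<open>'k\<close>-linear operators is a subset of it, with the same norm; for
  \<open>'k = real\<close> the condition below is automatic.
\<close>

definition bounded_ops ::
    "('k \<Rightarrow> 'e \<Rightarrow> 'e) \<Rightarrow> ('k \<Rightarrow> 'f \<Rightarrow> 'f) \<Rightarrow>
     ('e::real_normed_vector \<Rightarrow>\<^sub>L 'f::real_normed_vector) set" where
  "bounded_ops sE sF =
     {T. \<forall>c x. blinfun_apply T (sE c x) = sF c (blinfun_apply T x)}"

definition dual_space ::
    "('k \<Rightarrow> 'e \<Rightarrow> 'e) \<Rightarrow> ('e::real_normed_vector \<Rightarrow>\<^sub>L 'k::real_or_complex) set" where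
  "dual_space sE = bounded_ops sE (*)"

definition slope_function_at ::
    "('k \<Rightarrow> 'e \<Rightarrow> 'e) \<Rightarrow> ('k \<Rightarrow> 'f \<Rightarrow> 'f) \<Rightarrow> 'e set \<Rightarrow> ('e \<Rightarrow> 'f) \<Rightarrow> 'e \<Rightarrow>
     ('e::real_normed_vector \<Rightarrow> ('e \<Rightarrow>\<^sub>L 'f::real_normed_vector)) \<Rightarrow> bool" where
  "slope_function_at sE sF U f x \<Phi> \<longleftrightarrow>
     (\<forall>y\<in>U. \<Phi> y \<in> bounded_ops sE sF) \<and>
     continuous (at x within U) \<Phi> \<and>
     (\<forall>y\<in>U. f y = f x + blinfun_apply (\<Phi> y) (y - x))"

definition slope_differentiable_on ::
    "('k \<Rightarrow> 'e \<Rightarrow> 'e) \<Rightarrow> ('k \<Rightarrow> 'f \<Rightarrow> 'f) \<Rightarrow> 'e set \<Rightarrow>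
     ('e::real_normed_vector \<Rightarrow> 'f::real_normed_vector) \<Rightarrow> bool" where
  "slope_differentiable_on sE sF U f \<longleftrightarrow>
     (\<forall>x\<in>U. \<exists>\<Phi>. slope_function_at sE sF U f x \<Phi>)"

text \<open>The description operator is justified by \<open>slope_deriv_eq\<close> below.\<close>

definition slope_deriv ::
    "('k \<Rightarrow> 'e \<Rightarrow> 'e) \<Rightarrow> ('k \<Rightarrow> 'f \<Rightarrow> 'f) \<Rightarrow> 'e set \<Rightarrow> ('e \<Rightarrow> 'f) \<Rightarrow> 'e \<Rightarrow>
     ('e::real_normed_vector \<Rightarrow>\<^sub>L 'f::real_normed_vector)" where
  "slope_deriv sE sF U f x = (THE T. \<exists>\<Phi>. slope_function_at sE sF U f x \<Phi> \<and> T = \<Phi> x)"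

definition slope_function ::
    "('k \<Rightarrow> 'e \<Rightarrow> 'e) \<Rightarrow> ('k \<Rightarrow> 'f \<Rightarrow> 'f) \<Rightarrow> 'e set \<Rightarrow> ('e \<Rightarrow> 'f) \<Rightarrow>
     ('e::real_normed_vector \<times> 'e \<Rightarrow> ('e \<Rightarrow>\<^sub>L 'f::real_normed_vector)) \<Rightarrow> bool" where
  "slope_function sE sF U f \<Phi> \<longleftrightarrow>
     (\<forall>x\<in>U. slope_function_at sE sF U f x (\<lambda>y. \<Phi> (x, y)))"

definition norming_functionals ::
    "('k \<Rightarrow> 'e \<Rightarrow> 'e) \<Rightarrow> 'e set \<Rightarrow>
     ('e::real_normed_vector \<Rightarrow> 'e \<Rightarrow> ('e \<Rightarrow>\<^sub>L 'k::real_or_complex)) \<Rightarrow> bool" where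
  "norming_functionals sE U l \<longleftrightarrow>
     (\<forall>x\<in>U. \<forall>y\<in>U. x \<noteq> y \<longrightarrow>
        l x y \<in> dual_space sE \<and> norm (l x y) = 1 \<and>
        blinfun_apply (l x y) (y - x) = of_real (norm (y - x)))"

text \<open>
  \<^const>\<open>Blinfun\<close> turns a function into an operator; it is meaningful only on bounded linear
  functions, see \<open>canonical_slope_apply\<close> below.
\<close>

definition canonical_slope ::
    "('k \<Rightarrow> 'e \<Rightarrow> 'e) \<Rightarrow> ('k \<Rightarrow> 'f \<Rightarrow> 'f) \<Rightarrow> 'e set \<Rightarrow> ('e \<Rightarrow> 'f) \<Rightarrow>
     ('e \<Rightarrow> 'e \<Rightarrow> ('e \<Rightarrow>\<^sub>L 'k::real_or_complex)) \<Rightarrow>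
     ('e::real_normed_vector \<times> 'e \<Rightarrow> ('e \<Rightarrow>\<^sub>L 'f::real_normed_vector))" where
  "canonical_slope sE sF U f l = (\<lambda>(x, y).
     if x = y then slope_deriv sE sF U f x
     else Blinfun (\<lambda>z.
       sF (blinfun_apply (l x y) z)
          ((f y - f x - blinfun_apply (slope_deriv sE sF U f x) (y - x)) /\<^sub>R norm (y - x))
       + blinfun_apply (slope_deriv sE sF U f x) z))"

lemma slope_deriv_eq:
  fixes sE :: "'k \<Rightarrow> 'e \<Rightarrow> 'e::real_normed_vector"
    and sF :: "'k \<Rightarrow> 'f \<Rightarrow> 'f::real_normed_vector"
  assumes "open U" "x \<in> U" "slope_function_at sE sF U f x \<Phi>"
  shows "slope_deriv sE sF U f x = \<Phi> x"
proof -
  have unique: "\<Psi> x = \<Phi> x" if \<Psi>: "slope_function_at sE sF U f x \<Psi>" for \<Psi>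
  proof (rule blinfun_eqI)
    fix z
    define g where "g = (\<lambda>t::real. x + t *\<^sub>R z)"
    have g: "(g \<longlongrightarrow> x) (at 0)"
      unfolding g_def by (auto intro!: tendsto_eq_intros)
    have gU: "\<forall>\<^sub>F t in at 0. g t \<in> U"
      by (rule topological_tendstoD[OF g assms(1,2)])
    have cont: "isCont \<Phi> x" "isCont \<Psi> x"
      using assms(3) \<Psi> at_within_open[OF assms(2,1)] by (simp_all add: slope_function_at_def)
    have lim: "((\<lambda>t. blinfun_apply (\<Psi> (g t)) z - blinfun_apply (\<Phi> (g t)) z) \<longlongrightarrow>
        blinfun_apply (\<Psi> x) z - blinfun_apply (\<Phi> x) z) (at 0)"
      by (intro tendsto_intros isCont_tendsto_compose[OF cont(1) g]
          isCont_tendsto_compose[OF cont(2) g])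
    have "\<forall>\<^sub>F t in at 0. blinfun_apply (\<Psi> (g t)) z - blinfun_apply (\<Phi> (g t)) z = 0"
      using gU eventually_neq_at_within[of 0 0 UNIV]
    proof eventually_elim
      case (elim t)
      have "f (g t) = f x + blinfun_apply (\<Psi> (g t)) (g t - x)"
        "f (g t) = f x + blinfun_apply (\<Phi> (g t)) (g t - x)"
        using elim \<Psi> assms(3) by (auto simp: slope_function_at_def)
      then have "t *\<^sub>R blinfun_apply (\<Psi> (g t)) z = t *\<^sub>R blinfun_apply (\<Phi> (g t)) z"
        by (simp add: g_def blinfun.scaleR_right)
      then show ?case using elim by simp
    qed
    then have "((\<lambda>t. blinfun_apply (\<Psi> (g t)) z - blinfun_apply (\<Phi> (g t)) z) \<longlongrightarrow> 0) (at 0)"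
      by (rule tendsto_eventually)
    from tendsto_unique[OF _ lim this] show "blinfun_apply (\<Psi> x) z = blinfun_apply (\<Phi> x) z"
      by simp
  qed
  show ?thesis
    unfolding slope_deriv_def
  proof (rule the_equality)
    show "\<exists>\<Psi>. slope_function_at sE sF U f x \<Psi> \<and> \<Phi> x = \<Psi> x"
      using assms(3) by blast
    show "T = \<Phi> x" if "\<exists>\<Psi>. slope_function_at sE sF U f x \<Psi> \<and> T = \<Psi> x" for T
      using that unique by metis
  qed
qed

lemma canonical_slope_apply:
  fixes sE :: "'k::real_or_complex \<Rightarrow> 'e \<Rightarrow> 'e::real_normed_vector"
    and sF :: "'k \<Rightarrow> 'f \<Rightarrow> 'f::banach"
  assumes "banach_over sF" "x \<noteq> y"
  shows "blinfun_apply (canonical_slope sE sF U f l (x, y)) z =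
       sF (blinfun_apply (l x y) z)
          ((f y - f x - blinfun_apply (slope_deriv sE sF U f x) (y - x)) /\<^sub>R norm (y - x))
       + blinfun_apply (slope_deriv sE sF U f x) z"
proof -
  interpret F: banach_over sF by fact
  have sF: "bounded_linear (\<lambda>c. sF c v)" for v
  proof (rule bounded_linear_intro[where K = "norm v"])
    show "sF (r *\<^sub>R c) v = r *\<^sub>R sF c v" for r c
      by (simp add: scaleR_conv_of_real F.scale_of_real flip: F.scale_scale)
  qed (auto simp: F.scale_left_distrib F.norm_scale)
  have "bounded_linear (\<lambda>z. sF (blinfun_apply (l x y) z) v + blinfun_apply T z)"
    for v and T :: "'e \<Rightarrow>\<^sub>L 'f"
    by (intro bounded_linear_add bounded_linear_compose[OF sF] blinfun.bounded_linear_right)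
  then show ?thesis
    using assms(2) by (simp add: canonical_slope_def bounded_linear_Blinfun_apply)
qed

end

theory Submission imports Defs begin

text \<open>
  A jointly continuous slope function equals \<open>Df\<close> on the diagonal, so it makes \<open>Df\<close> continuous.
  For the converse, fix \<open>x\<close> and \<open>y\<close> and consider all bounded \<open>'k\<close>-linear operators \<open>T\<close> with
  \<open>T (y - x) = f y - f x\<close>. These are the admissible values at \<open>(x, y)\<close> of a slope function, and
  the question is how close to \<open>Df x\<close> such a \<open>T\<close> can be.

  The heart of the matter is a mean value theorem with operators as mean values
  (\<open>mean_value_operator\<close>): if \<open>Df\<close> maps the segment from \<open>x\<close> to \<open>y\<close> into an open convex set \<open>B\<close>
  of operators, then some admissible \<open>T\<close> lies in \<open>B\<close>. On short subintervals the pointwise slope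
  functions provide such operators, and the slope over a union of adjacent intervals is a convex
  combination of the slopes over the parts. If \<open>Df\<close> is continuous at \<open>x0\<close>, take for \<open>B\<close> a small ball
  around \<open>Df x0\<close>: for \<open>x\<close> and \<open>y\<close> near \<open>x0\<close> there is an admissible \<open>T\<close> close to \<open>Df x0\<close>, hence
  close to \<open>Df x\<close>. So every map \<open>\<Phi>\<close> for which \<open>\<Phi> (x, y)\<close> is, up to an error \<open>norm (y - x)\<close>, at least
  as close to \<open>Df x\<close> as any admissible operator is jointly continuous at \<open>(x0, x0)\<close>
  (\<open>continuous_if_near_optimal\<close>).

  This settles both assertions. A near-optimal \<open>\<Phi>\<close> can simply be chosen, and it is a slope function
  because at each \<open>x\<close> it competes with the slope function that differentiability at \<open>x\<close> provides. The
  canonical slope function, for whatever norming functionals, is exactly optimal: its distance to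
  \<open>Df x\<close> is the norm of the remainder divided by \<open>norm (y - x)\<close>, which no admissible operator can beat.
\<close>

section \<open>Operators linear over the scalar field\<close>

lemma (in banach_over) scale_scaleR_commute: "scale c (r *\<^sub>R x) = r *\<^sub>R scale c x"
  by (metis mult.commute scale_of_real scale_scale)

lemma bounded_ops_add:
  assumes "banach_over sF" "S \<in> bounded_ops sE sF" "T \<in> bounded_ops sE sF"
  shows "S + T \<in> bounded_ops sE sF"
proof -
  interpret F: banach_over sF by fact
  show ?thesis
    using assms(2,3) by (simp add: bounded_ops_def blinfun.add_left F.scale_right_distrib)
qed

lemma bounded_ops_scaleR:
  assumes "banach_over sF" "T \<in> bounded_ops sE sF"
  shows "r *\<^sub>R T \<in> bounded_ops sE sF"
proof -
  interpret F: banach_over sF by fact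
  show ?thesis
    using assms(2) by (simp add: bounded_ops_def blinfun.scaleR_left F.scale_scaleR_commute)
qed

section \<open>Derivatives and slope functions\<close>

lemma slope_deriv_obtain_slope:
  assumes "open U" "slope_differentiable_on sE sF U f" "x \<in> U"
  obtains \<Psi> where "slope_function_at sE sF U f x \<Psi>" "\<Psi> x = slope_deriv sE sF U f x"
  using assms slope_deriv_eq[OF assms(1,3)] unfolding slope_differentiable_on_def by metis

lemma slope_deriv_in_bounded_ops:
  assumes "open U" "slope_differentiable_on sE sF U f" "x \<in> U"
  shows "slope_deriv sE sF U f x \<in> bounded_ops sE sF"
  using slope_deriv_obtain_slope[OF assms] assms(3) unfolding slope_function_at_def by metis

text \<open>The easy half of the equivalence: the derivative is the restriction to the diagonal.\<close>

lemma continuous_slope_deriv_if_continuous_slope: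
  assumes "open U" "x0 \<in> U" "slope_function sE sF U f \<Phi>"
    and cont: "continuous (at (x0, x0) within U \<times> U) \<Phi>"
  shows "continuous (at x0 within U) (slope_deriv sE sF U f)"
proof -
  have diag: "slope_deriv sE sF U f x = \<Phi> (x, x)" if "x \<in> U" for x
    using slope_deriv_eq[OF assms(1) that] assms(3) that
    by (fastforce simp: slope_function_def)
  have "((\<lambda>x. (x, x)) \<longlongrightarrow> (x0, x0)) (at x0 within U)"
    by (intro tendsto_intros)
  moreover have "\<forall>\<^sub>F x in at x0 within U. (x, x) \<in> U \<times> U \<and> (x, x) \<noteq> (x0, x0)"
    by (auto simp: eventually_at_filter)
  ultimately have "filterlim (\<lambda>x. (x, x)) (at (x0, x0) within U \<times> U) (at x0 within U)"
    by (auto simp: filterlim_at elim: eventually_mono)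
  from filterlim_compose[OF cont[unfolded continuous_within] this]
  have "((\<lambda>x. \<Phi> (x, x)) \<longlongrightarrow> \<Phi> (x0, x0)) (at x0 within U)" .
  moreover have "\<forall>\<^sub>F x in at x0 within U. \<Phi> (x, x) = slope_deriv sE sF U f x"
    using diag by (auto simp: eventually_at_filter)
  ultimately show ?thesis
    using diag[OF assms(2)] by (simp add: continuous_within tendsto_cong)
qed

section \<open>The mean value theorem\<close>

text \<open>
  Call an interval of parameters good if \<open>f\<close> has a slope in \<open>B\<close> over it. Adjacent good intervals
  have a good union, because the slope over the union is the average of the two slopes, weighted
  by the lengths; and every point has a neighbourhood in which the intervals containing the point are
  good. By Bolzano's bisection argument, the whole interval is good.
\<close>

lemma mean_value_operator:
  fixes sE :: "'k::real_or_complex \<Rightarrow> 'e::banach \<Rightarrow> 'e"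
    and sF :: "'k \<Rightarrow> 'f::banach \<Rightarrow> 'f"
    and B :: "('e \<Rightarrow>\<^sub>L 'f) set"
  assumes F: "banach_over sF" and U: "open U" and diff: "slope_differentiable_on sE sF U f"
    and seg: "closed_segment x y \<subseteq> U"
    and B: "open B" "convex B" "\<And>c. c \<in> closed_segment x y \<Longrightarrow> slope_deriv sE sF U f c \<in> B"
  obtains T where "T \<in> bounded_ops sE sF" "T \<in> B" "f y - f x = blinfun_apply T (y - x)"
proof -
  define g where "g t = x + t *\<^sub>R (y - x)" for t :: real
  define good where "good s t \<longleftrightarrow> (\<exists>T. T \<in> bounded_ops sE sF \<and> T \<in> B \<and>
    f (g t) - f (g s) = (t - s) *\<^sub>R blinfun_apply T (y - x))" for s t
  have g_diff: "g t - g s = (t - s) *\<^sub>R (y - x)" for s t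
    by (simp add: g_def algebra_simps)
  have g_seg: "g t \<in> closed_segment x y" if "t \<in> {0..1}" for t
    using that unfolding in_segment
    by (intro exI[of _ t]) (auto simp: g_def algebra_simps)
  have good_trans: "good s u" if st: "s \<le> t" "t \<le> u" and good: "good s t" "good t u" for s t u
  proof (cases "s = u")
    case True
    then show ?thesis using that by auto
  next
    case False
    then have pos: "u - s > 0" using st by simp
    obtain S where S: "S \<in> bounded_ops sE sF" "S \<in> B"
      "f (g t) - f (g s) = (t - s) *\<^sub>R blinfun_apply S (y - x)"
      using good(1) by (auto simp: good_def)
    obtain T where T: "T \<in> bounded_ops sE sF" "T \<in> B"
      "f (g u) - f (g t) = (u - t) *\<^sub>R blinfun_apply T (y - x)"
      using good(2) by (auto simp: good_def)
    define R where "R = ((t - s) / (u - s)) *\<^sub>R S + ((u - t) / (u - s)) *\<^sub>R T"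
    have "R \<in> bounded_ops sE sF"
      unfolding R_def using S(1) T(1) by (intro bounded_ops_add bounded_ops_scaleR F)
    moreover have "R \<in> B"
      unfolding R_def
    proof (rule convexD[OF B(2) S(2) T(2)])
      show "(t - s) / (u - s) + (u - t) / (u - s) = 1"
        using pos by (simp flip: add_divide_distrib)
    qed (use st pos in auto)
    moreover have "(u - s) *\<^sub>R blinfun_apply R (y - x) =
        (t - s) *\<^sub>R blinfun_apply S (y - x) + (u - t) *\<^sub>R blinfun_apply T (y - x)"
      using pos by (simp add: R_def blinfun.add_left blinfun.scaleR_left scaleR_add_right)
    then have "f (g u) - f (g s) = (u - s) *\<^sub>R blinfun_apply R (y - x)"
      by (simp flip: S(3) T(3))
    ultimately show ?thesis unfolding good_def by blast
  qed
  have "good 0 1"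
  proof (rule Bolzano[of 0 1 good])
    show "\<exists>d>0. \<forall>a b. a \<le> r \<and> r \<le> b \<and> b - a < d \<longrightarrow> good a b"
      if r: "0 \<le> r" "r \<le> 1" for r
    proof -
      have rU: "g r \<in> U" using g_seg[of r] seg r by auto
      obtain \<Psi> where \<Psi>: "slope_function_at sE sF U f (g r) \<Psi>"
        "\<Psi> (g r) = slope_deriv sE sF U f (g r)"
        using slope_deriv_obtain_slope[OF U diff rU] .
      have "isCont \<Psi> (g r)"
        using \<Psi>(1) at_within_open[OF rU U] by (simp add: slope_function_at_def)
      moreover have g_cont: "isCont g r" unfolding g_def by (intro continuous_intros)
      ultimately have cont: "isCont (\<lambda>t. \<Psi> (g t)) r"
        by (rule isCont_o2[rotated])
      have "\<Psi> (g r) \<in> B" using B(3) g_seg[of r] r \<Psi>(2) by auto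
      then have "\<forall>\<^sub>F t in nhds r. g t \<in> U \<and> \<Psi> (g t) \<in> B"
        using cont g_cont U B(1) rU
        by (intro eventually_conj topological_tendstoD) (auto simp: isCont_def tendsto_nhds_iff)
      then obtain d where d: "d > 0" "\<And>t. dist t r < d \<Longrightarrow> g t \<in> U \<and> \<Psi> (g t) \<in> B"
        by (auto simp: eventually_nhds_metric)
      \<comment> \<open>The slope function at \<open>g r\<close> gives slopes only over intervals with endpoint \<open>r\<close>; an
        interval with \<open>r\<close> inside is cut at \<open>r\<close>.\<close>
      have "good a b" if ab: "a \<le> r" "r \<le> b" "b - a < d" for a b
      proof (rule good_trans[OF ab(1,2)])
        have slope: "\<Psi> (g t) \<in> bounded_ops sE sF \<and> \<Psi> (g t) \<in> B \<and>
            f (g t) - f (g r) = (t - r) *\<^sub>R blinfun_apply (\<Psi> (g t)) (y - x)"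
          if "dist t r < d" for t
          using d(2)[OF that] \<Psi>(1)
          by (auto simp: slope_function_at_def g_diff blinfun.scaleR_right)
        show "good a r"
          unfolding good_def
        proof (intro exI conjI)
          have *: "dist a r < d" using ab by (auto simp: dist_real_def)
          show "\<Psi> (g a) \<in> bounded_ops sE sF" "\<Psi> (g a) \<in> B" using slope[OF *] by auto
          have "f (g r) - f (g a) = - ((a - r) *\<^sub>R blinfun_apply (\<Psi> (g a)) (y - x))"
            using slope[OF *] by (metis minus_diff_eq)
          then show "f (g r) - f (g a) = (r - a) *\<^sub>R blinfun_apply (\<Psi> (g a)) (y - x)"
            by (simp flip: scaleR_minus_left)
        qed
        have "dist b r < d" using ab by (auto simp: dist_real_def)
        from slope[OF this] show "good r b" unfolding good_def by blast
      qed
      then show ?thesis using d(1) by blast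
    qed
  qed (use good_trans in auto)
  then show thesis using that by (auto simp: good_def g_def)
qed

section \<open>Near-optimal slopes\<close>

text \<open>
  Near \<open>x0\<close>, the mean value theorem supplies a competitor \<open>T\<close> close to \<open>Df x0\<close>. Quantifying over \<open>T\<close> expresses
  near-optimality without an infimum; for \<open>y = x\<close> the competitor \<open>Df x\<close> forces \<open>\<Phi> (x, x) = Df x\<close>.
\<close>

lemma continuous_if_near_optimal:
  fixes sE :: "'k::real_or_complex \<Rightarrow> 'e::banach \<Rightarrow> 'e"
    and sF :: "'k \<Rightarrow> 'f::banach \<Rightarrow> 'f"
  assumes F: "banach_over sF" and U: "open U" and diff: "slope_differentiable_on sE sF U f"
    and x0: "x0 \<in> U"
    and cont: "continuous (at x0 within U) (slope_deriv sE sF U f)"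
    and opt: "\<And>x y T. x \<in> U \<Longrightarrow> y \<in> U \<Longrightarrow> T \<in> bounded_ops sE sF \<Longrightarrow>
        f y - f x = blinfun_apply T (y - x) \<Longrightarrow>
        norm (\<Phi> (x, y) - slope_deriv sE sF U f x) \<le>
          norm (T - slope_deriv sE sF U f x) + norm (y - x)"
  shows "continuous (at (x0, x0) within U \<times> U) \<Phi>"
  unfolding continuous_within_eps_delta
proof (intro allI impI)
  define D where "D = slope_deriv sE sF U f"
  have diag: "\<Phi> (x0, x0) = D x0"
    using opt[OF x0 x0 slope_deriv_in_bounded_ops[OF U diff x0]]
    by (simp add: D_def blinfun.zero_right)
  fix e :: real
  assume e: "e > 0"
  obtain d1 where d1: "d1 > 0" "ball x0 d1 \<subseteq> U" using U x0 openE by blast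
  obtain d2 where d2: "d2 > 0" "\<And>x. x \<in> U \<Longrightarrow> dist x x0 < d2 \<Longrightarrow> dist (D x) (D x0) < e / 4"
    using cont e unfolding continuous_within_eps_delta D_def
    by (metis divide_pos_pos zero_less_numeral)
  \<comment> \<open>Below \<open>D x\<close> is used twice and \<open>T\<close> once, each within \<open>e / 4\<close> of \<open>D x0\<close>; the bound
    \<open>e / 8\<close> keeps \<open>norm (y - x)\<close> below the remaining quarter.\<close>
  define d where "d = min (min d1 d2) (e / 8)"
  have "dist (\<Phi> p) (\<Phi> (x0, x0)) < e" if p: "p \<in> U \<times> U" "dist p (x0, x0) < d" for p
  proof -
    obtain x y where xy: "p = (x, y)" "x \<in> U" "y \<in> U" using p by auto
    have "dist x x0 < d" "dist y x0 < d"
      using p(2) dist_fst_le[of p "(x0, x0)"] dist_snd_le[of p "(x0, x0)"] by (auto simp: xy)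
    then have near: "x \<in> ball x0 d" "y \<in> ball x0 d" by (auto simp: dist_commute)
    then have seg: "closed_segment x y \<subseteq> ball x0 d"
      by (intro closed_segment_subset convex_ball)
    moreover have "ball x0 d \<subseteq> ball x0 d1" by (intro subset_ball) (simp add: d_def)
    ultimately have segU: "closed_segment x y \<subseteq> U" using d1(2) by blast
    have DB: "D c \<in> ball (D x0) (e / 4)" if "c \<in> closed_segment x y" for c
    proof -
      have "c \<in> U" "dist c x0 < d2" using that seg segU by (auto simp: d_def dist_commute)
      then show ?thesis using d2(2) by (simp add: dist_commute)
    qed
    obtain T where T: "T \<in> bounded_ops sE sF" "T \<in> ball (D x0) (e / 4)"
      "f y - f x = blinfun_apply T (y - x)"
      using mean_value_operator[OF F U diff segU open_ball convex_ball DB[unfolded D_def]]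
      unfolding D_def by blast
    have "norm (y - x) < e / 4"
      using near dist_triangle2[of y x x0] by (auto simp: d_def dist_norm norm_minus_commute)
    moreover have "dist (\<Phi> p) (D x) \<le> dist T (D x) + norm (y - x)"
      using opt[OF xy(2,3) T(1,3)] by (simp add: xy(1) D_def dist_norm)
    moreover have "dist (D x) (D x0) < e / 4" "dist T (D x0) < e / 4"
      using DB[of x] T(2) by (auto simp: dist_commute)
    moreover have "dist T (D x) \<le> dist T (D x0) + dist (D x) (D x0)"
      by (rule dist_triangle2)
    moreover have "dist (\<Phi> p) (D x0) \<le> dist (\<Phi> p) (D x) + dist (D x) (D x0)"
      by (rule dist_triangle)
    ultimately show ?thesis unfolding diag by linarith
  qed
  moreover have "d > 0" using d1 d2 e by (simp add: d_def)
  ultimately show "\<exists>d>0. \<forall>p\<in>U \<times> U. dist p (x0, x0) < d \<longrightarrow> dist (\<Phi> p) (\<Phi> (x0, x0)) < e"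
    by blast
qed

text \<open>
  The infimum of the distances to \<open>Df x\<close> need not be attained among the admissible operators, hence
  the error \<open>norm (y - x)\<close>, which is positive off the diagonal and vanishes in the limit.
\<close>

lemma near_optimal_slope_exists:
  fixes sE :: "'k::real_or_complex \<Rightarrow> 'e::banach \<Rightarrow> 'e"
    and sF :: "'k \<Rightarrow> 'f::banach \<Rightarrow> 'f"
  assumes U: "open U" and diff: "slope_differentiable_on sE sF U f"
  obtains \<Phi> where "slope_function sE sF U f \<Phi>"
    and "\<And>x y T. x \<in> U \<Longrightarrow> y \<in> U \<Longrightarrow> T \<in> bounded_ops sE sF \<Longrightarrow>
        f y - f x = blinfun_apply T (y - x) \<Longrightarrow>
        norm (\<Phi> (x, y) - slope_deriv sE sF U f x) \<le>
          norm (T - slope_deriv sE sF U f x) + norm (y - x)"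
proof -
  define D where "D = slope_deriv sE sF U f"
  define S where "S x y = {T \<in> bounded_ops sE sF. f y - f x = blinfun_apply T (y - x)}" for x y
  have "\<exists>T\<in>S x y. \<forall>T'\<in>S x y. norm (T - D x) \<le> norm (T' - D x) + norm (y - x)"
    if xy: "x \<in> U" "y \<in> U" for x y
  proof (cases "x = y")
    case True
    then have "D x \<in> S x y"
      using slope_deriv_in_bounded_ops[OF U diff \<open>x \<in> U\<close>]
      by (simp add: S_def D_def blinfun.zero_right)
    then show ?thesis by (intro bexI[of _ "D x"]) auto
  next
    case False
    define N where "N = (\<lambda>T. norm (T - D x)) ` S x y"
    obtain \<Psi> where \<Psi>: "slope_function_at sE sF U f x \<Psi>"
      using slope_deriv_obtain_slope[OF U diff xy(1)] by blast
    then have "\<Psi> y \<in> S x y"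
      using xy(2) by (auto simp: S_def slope_function_at_def)
    then have "N \<noteq> {}" by (auto simp: N_def)
    moreover have "Inf N < Inf N + norm (y - x)" using False by simp
    ultimately obtain T where T: "T \<in> S x y" "norm (T - D x) < Inf N + norm (y - x)"
      using cInf_lessD[of N] unfolding N_def by blast
    have "bdd_below N" by (auto simp: N_def intro!: bdd_belowI[of _ 0])
    then have "Inf N \<le> norm (T' - D x)" if "T' \<in> S x y" for T'
      using that by (auto simp: N_def intro!: cInf_lower)
    then show ?thesis using T by (intro bexI[of _ T]) force+
  qed
  then obtain \<phi> where \<phi>: "\<And>x y. x \<in> U \<Longrightarrow> y \<in> U \<Longrightarrow> \<phi> x y \<in> S x y"
    and opt: "\<And>x y T'. x \<in> U \<Longrightarrow> y \<in> U \<Longrightarrow> T' \<in> S x y \<Longrightarrow>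
      norm (\<phi> x y - D x) \<le> norm (T' - D x) + norm (y - x)"
    by metis
  have "slope_function_at sE sF U f x (\<phi> x)" if x: "x \<in> U" for x
    unfolding slope_function_at_def
  proof (intro conjI ballI)
    obtain \<Psi> where \<Psi>: "slope_function_at sE sF U f x \<Psi>" "\<Psi> x = D x"
      using slope_deriv_obtain_slope[OF U diff x] unfolding D_def .
    have \<Psi>S: "\<Psi> y \<in> S x y" if "y \<in> U" for y
      using that \<Psi>(1) by (auto simp: S_def slope_function_at_def)
    have diag: "\<phi> x x = D x" using opt[OF x x \<Psi>S[OF x]] \<Psi>(2) by simp
    have "(\<Psi> \<longlongrightarrow> D x) (at x within U)"
      using \<Psi> by (auto simp: slope_function_at_def continuous_within)
    then have "((\<lambda>y. norm (\<Psi> y - D x) + norm (y - x)) \<longlongrightarrow> norm (D x - D x) + norm (x - x))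
        (at x within U)"
      by (intro tendsto_intros)
    then have lim: "((\<lambda>y. norm (\<Psi> y - D x) + norm (y - x)) \<longlongrightarrow> 0) (at x within U)"
      by simp
    have "\<forall>\<^sub>F y in at x within U. norm (\<phi> x y - D x) \<le> norm (\<Psi> y - D x) + norm (y - x)"
      using opt[OF x _ \<Psi>S] by (auto simp: eventually_at_filter)
    from Lim_null_comparison[OF this lim] show "continuous (at x within U) (\<phi> x)"
      unfolding continuous_within diag by (rule Lim_null[THEN iffD2])
  qed (use \<phi>[OF x] in \<open>auto simp: S_def algebra_simps\<close>)
  then show thesis
    using opt by (intro that[of "\<lambda>(x, y). \<phi> x y"]) (auto simp: slope_function_def S_def D_def)
qed

text \<open>
  Off the diagonal, \<open>\<Phi> (x, y) - Df x\<close> is the operator of rank at most one built from \<open>l x y\<close>, of norm one, and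
  the remainder \<open>f y - f x - Df x (y - x) = (T - Df x) (y - x)\<close> divided by \<open>norm (y - x)\<close>.
\<close>

lemma canonical_slope_optimal:
  fixes sE :: "'k::real_or_complex \<Rightarrow> 'e::banach \<Rightarrow> 'e"
    and sF :: "'k \<Rightarrow> 'f::banach \<Rightarrow> 'f"
  assumes F: "banach_over sF" and l: "norming_functionals sE U l" and xy: "x \<in> U" "y \<in> U"
    and T: "f y - f x = blinfun_apply T (y - x)"
  shows "norm (canonical_slope sE sF U f l (x, y) - slope_deriv sE sF U f x) \<le>
    norm (T - slope_deriv sE sF U f x)"
proof (cases "x = y")
  case True
  then show ?thesis by (simp add: canonical_slope_def)
next
  case False
  interpret F: banach_over sF by fact
  define A where "A = slope_deriv sE sF U f x"
  define w where "w = (f y - f x - blinfun_apply A (y - x)) /\<^sub>R norm (y - x)"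
  have "norm w = norm (blinfun_apply (T - A) (y - x)) / norm (y - x)"
    by (simp add: w_def T blinfun.diff_left divide_inverse mult.commute)
  also have "\<dots> \<le> norm (T - A)"
    using False norm_blinfun[of "T - A" "y - x"] by (simp add: divide_le_eq)
  finally have w: "norm w \<le> norm (T - A)" .
  have norm_l: "norm (l x y) = 1" using l xy False by (auto simp: norming_functionals_def)
  have "norm (canonical_slope sE sF U f l (x, y) - A) \<le> norm (T - A)"
  proof (rule norm_blinfun_bound)
    fix z
    have "norm (blinfun_apply (canonical_slope sE sF U f l (x, y) - A) z) =
        norm (blinfun_apply (l x y) z) * norm w"
      using False
      by (simp add: blinfun.diff_left canonical_slope_apply[OF F] F.norm_scale flip: A_def w_def)
    also have "\<dots> \<le> norm z * norm (T - A)"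
      using norm_blinfun[of "l x y" z] w by (intro mult_mono) (auto simp: norm_l)
    finally show "norm (blinfun_apply (canonical_slope sE sF U f l (x, y) - A) z) \<le>
        norm (T - A) * norm z"
      by (simp add: mult.commute)
  qed simp
  then show ?thesis by (simp add: A_def)
qed

section \<open>Continuity of the derivative\<close>

theorem theorem4p1:
  fixes sE :: "'k::real_or_complex \<Rightarrow> 'e::banach \<Rightarrow> 'e"
    and sF :: "'k \<Rightarrow> 'f::banach \<Rightarrow> 'f"
    and U :: "'e set" and f :: "'e \<Rightarrow> 'f" and x0 :: 'e
  assumes "banach_over sE" and "banach_over sF"
    and "open U" and "slope_differentiable_on sE sF U f" and "x0 \<in> U"
  shows "(continuous (at x0 within U) (slope_deriv sE sF U f) \<longleftrightarrow>
           (\<exists>\<Phi>. slope_function sE sF U f \<Phi> \<and>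
                continuous (at (x0, x0) within U \<times> U) \<Phi>)) \<and>
         (continuous (at x0 within U) (slope_deriv sE sF U f) \<longrightarrow>
           (\<forall>l. norming_functionals sE U l \<longrightarrow>
                continuous (at (x0, x0) within U \<times> U) (canonical_slope sE sF U f l)))"
proof (intro conjI iffI impI allI)
  let ?D = "slope_deriv sE sF U f"
  note near_optimal = continuous_if_near_optimal[OF assms(2-5)]
  show "\<exists>\<Phi>. slope_function sE sF U f \<Phi> \<and> continuous (at (x0, x0) within U \<times> U) \<Phi>"
    if cont: "continuous (at x0 within U) ?D"
  proof -
    obtain \<Phi> where \<Phi>: "slope_function sE sF U f \<Phi>"
      and "\<And>x y T. x \<in> U \<Longrightarrow> y \<in> U \<Longrightarrow> T \<in> bounded_ops sE sF \<Longrightarrow>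
        f y - f x = blinfun_apply T (y - x) \<Longrightarrow>
        norm (\<Phi> (x, y) - ?D x) \<le> norm (T - ?D x) + norm (y - x)"
      using near_optimal_slope_exists[OF assms(3,4)] by blast
    with near_optimal[OF cont] show ?thesis by blast
  qed
  show "continuous (at x0 within U) ?D"
    if "\<exists>\<Phi>. slope_function sE sF U f \<Phi> \<and> continuous (at (x0, x0) within U \<times> U) \<Phi>"
    using that continuous_slope_deriv_if_continuous_slope[OF assms(3,5)] by blast
  show "continuous (at (x0, x0) within U \<times> U) (canonical_slope sE sF U f l)"
    if cont: "continuous (at x0 within U) ?D" and l: "norming_functionals sE U l" for l
    using near_optimal[OF cont] canonical_slope_optimal[OF assms(2) l]
    by (meson add_increasing2 norm_ge_zero)
qed

end
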